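(* For any integers $\ell \geq 4$, $k \geq 3$ and $n \geq \frac{\ell}{k}$, $sat(K_k^n,C_{\ell}) \geq kn$.
   Context: All graphs are finite, simple and undirected. $K_k^n$ denotes the complete $k$-partite graph with exactly $n$ vertices in each of its $k$ parts. $C_\ell$ denotes the cycle on $\ell$ vertices. For graphs $G$ and $F$, a spanning subgraph $H$ of $G$ is $F$-saturated relative to $G$ if $H$ contains no copy of $F$ but $H+e$ contains a copy of $F$ for every $e\in E(G)\setminus E(H)$; $sat(G,F)$ is the minimum number of edges of a graph that is $F$-saturated relative to $G$. *)

theory Defs
  imports Complex_Main
begin

datatype 'a ugraph = Graph (verts: "'a set") (edges: "'a set set")

definition simple_graph :: "'a ugraph \<Rightarrow> bool" where
  "simple_graph G \<longleftrightarrow> finite (verts G) \<and> (\<forall>e \<in> edges G. e \<subseteq> verts G \<and> card e = 2)"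

definition spanning_subgraph :: "'a ugraph \<Rightarrow> 'a ugraph \<Rightarrow> bool" where
  "spanning_subgraph H G \<longleftrightarrow> verts H = verts G \<and> edges H \<subseteq> edges G"

definition add_edge :: "'a ugraph \<Rightarrow> 'a set \<Rightarrow> 'a ugraph" where
  "add_edge H e = Graph (verts H) (insert e (edges H))"

(* A copy of F is a subgraph isomorphic to F, not necessarily an induced one. *)
definition contains_copy :: "'a ugraph \<Rightarrow> 'b ugraph \<Rightarrow> bool" where
  "contains_copy H F \<longleftrightarrow>
     (\<exists>f. inj_on f (verts F) \<and> f ` verts F \<subseteq> verts H \<and> (\<forall>e \<in> edges F. f ` e \<in> edges H))"

definition saturated :: "'a ugraph \<Rightarrow> 'b ugraph \<Rightarrow> 'a ugraph \<Rightarrow> bool" where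
  "saturated G F H \<longleftrightarrow>
     spanning_subgraph H G \<and> \<not> contains_copy H F \<and>
     (\<forall>e \<in> edges G - edges H. contains_copy (add_edge H e) F)"

(* Meaningful for simple G and F with F having at least one edge: then a saturated graph exists. *)
definition sat :: "'a ugraph \<Rightarrow> 'b ugraph \<Rightarrow> nat" where
  "sat G F = Min {card (edges H) | H. saturated G F H}"

(* The vertex (i, a) is the a-th vertex of the i-th part. *)
definition complete_multipartite :: "nat \<Rightarrow> nat \<Rightarrow> (nat \<times> nat) ugraph" where
  "complete_multipartite k n =
     Graph ({..<k} \<times> {..<n})
           {{(i, a), (j, b)} | i a j b. i < k \<and> j < k \<and> i \<noteq> j \<and> a < n \<and> b < n}"

(* A cycle only for l \<ge> 3. *)
definition cycle_graph :: "nat \<Rightarrow> nat ugraph" where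
  "cycle_graph l = Graph {..<l} {{i, (i + 1) mod l} | i. i < l}"

lemma simple_complete_multipartite: "simple_graph (complete_multipartite k n)"
  by (auto simp: simple_graph_def complete_multipartite_def card_2_iff)

lemma simple_cycle_graph:
  assumes "l \<ge> 3"
  shows "simple_graph (cycle_graph l)"
proof -
  have "i \<noteq> (i + 1) mod l \<and> (i + 1) mod l < l" if "i < l" for i
    using that assms by (cases "i + 1 = l") auto
  then show ?thesis
    by (auto simp: simple_graph_def cycle_graph_def card_2_iff)
qed

end

(* A saturated graph H is connected: vertices of different parts are adjacent or are the ends of a
   path on l vertices. Suppose that some vertex w has neighbours u, v in different parts. Then
   H contains a cycle: either u and v are adjacent, or they are joined by a path on l >= 4
   vertices, which is not the path u, w, v. Deleting an edge of that cycle keeps H connected, so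
   H has at least as many edges as vertices. Otherwise the neighbours of each vertex
   lie in a single part, and by connectivity H meets at most two parts, contradicting k >= 3. *)
theory Submission
  imports Defs
begin

section \<open>Adjacency, connectedness and paths\<close>

definition adj :: "'a set set \<Rightarrow> ('a \<times> 'a) set" where
  "adj E = {(x, y). {x, y} \<in> E}"

definition connected_on :: "'a set \<Rightarrow> 'a set set \<Rightarrow> bool" where
  "connected_on V E \<longleftrightarrow> (\<forall>x\<in>V. \<forall>y\<in>V. (x, y) \<in> (adj E)\<^sup>*)"

text \<open>\<open>l\<close> counts vertices: for \<open>l > 0\<close> the path runs from
  \<open>p 0\<close> to \<open>p (l - 1)\<close> along \<open>l - 1\<close> edges.\<close>

definition path_in :: "'a set set \<Rightarrow> nat \<Rightarrow> (nat \<Rightarrow> 'a) \<Rightarrow> bool" where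
  "path_in E l p \<longleftrightarrow> inj_on p {..<l} \<and> (\<forall>j. Suc j < l \<longrightarrow> {p j, p (Suc j)} \<in> E)"

lemma sym_adj: "sym (adj E)"
  by (auto simp: sym_def adj_def insert_commute)

lemma rtrancl_adj_sym: "(x, y) \<in> (adj E)\<^sup>* \<Longrightarrow> (y, x) \<in> (adj E)\<^sup>*"
  using sym_adj sym_rtrancl symD by metis

lemma path_in_mono: "path_in E l p \<Longrightarrow> (\<And>j. Suc j < l \<Longrightarrow> {p j, p (Suc j)} \<in> F) \<Longrightarrow> path_in F l p"
  by (auto simp: path_in_def)

lemma path_in_rev:
  assumes "path_in E l p"
  shows "path_in E l (\<lambda>j. p (l - 1 - j))"
proof -
  have "inj_on (\<lambda>j. p (l - 1 - j)) {..<l}"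
    using assms by (force simp: path_in_def intro!: inj_onI dest: inj_onD)
  moreover have "{p (l - 1 - j), p (l - 1 - Suc j)} \<in> E" if "Suc j < l" for j
  proof -
    have "l - 1 - j = Suc (l - 1 - Suc j)" "Suc (l - 1 - Suc j) < l" using that by auto
    moreover from this have "{p (l - 1 - Suc j), p (Suc (l - 1 - Suc j))} \<in> E"
      using assms unfolding path_in_def by blast
    ultimately show ?thesis by (simp only: insert_commute)
  qed
  ultimately show ?thesis by (simp add: path_in_def)
qed

lemma path_in_rtrancl:
  assumes "path_in E l p" "j < l"
  shows "(p 0, p j) \<in> (adj E)\<^sup>*"
  using \<open>j < l\<close>
proof (induction j)
  case (Suc j)
  then have "(p j, p (Suc j)) \<in> adj E" using assms(1) by (auto simp: path_in_def adj_def)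
  with Suc show ?case by (meson Suc_lessD rtrancl.rtrancl_into_rtrancl)
qed simp

section \<open>Edge counts of connected graphs\<close>

text \<open>Each vertex other than a root is charged to an edge that leads closer to the root.\<close>

lemma card_le_Suc_card_edges:
  assumes E: "finite E" and conn: "connected_on V E"
  shows "card V \<le> Suc (card E)"
proof (cases "finite V \<and> V \<noteq> {}")
  case True
  then obtain r where r: "r \<in> V" and "finite V" by blast
  define d where "d v = (LEAST m. (v, r) \<in> adj E ^^ m)" for v
  have "\<exists>y. {v, y} \<in> E \<and> d y < d v" if "v \<in> V - {r}" for v
  proof -
    have "\<exists>m. (v, r) \<in> adj E ^^ m"
      using conn r that by (auto simp: connected_on_def rtrancl_is_UN_relpow)
    then have dv: "(v, r) \<in> adj E ^^ d v" unfolding d_def by (rule LeastI_ex)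
    moreover have "d v \<noteq> 0" using dv that by (metis DiffD2 relpow_0_E singletonI)
    then obtain m where m: "d v = Suc m" by (cases "d v") auto
    ultimately obtain y where y: "(v, y) \<in> adj E" "(y, r) \<in> adj E ^^ m"
      by (metis relpow_Suc_D2)
    then have "d y \<le> m" unfolding d_def by (metis Least_le)
    with y m show ?thesis by (auto simp: adj_def)
  qed
  then obtain q where q: "\<And>v. v \<in> V - {r} \<Longrightarrow> {v, q v} \<in> E \<and> d (q v) < d v" by metis
  have "inj_on (\<lambda>v. {v, q v}) (V - {r})"
  proof (rule inj_onI)
    fix v w assume "v \<in> V - {r}" "w \<in> V - {r}" "{v, q v} = {w, q w}"
    \<comment> \<open>If \<open>v\<close> and \<open>w\<close> differed, then \<open>v = q w\<close>
      and \<open>w = q v\<close>, so each would be strictly closer to \<open>r\<close> than the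
      other.\<close>
    then show "v = w" using q[of v] q[of w] by (auto simp: doubleton_eq_iff)
  qed
  then have "card (V - {r}) \<le> card E"
    using q by (intro card_inj_on_le[OF _ _ E]) auto
  then show ?thesis using r \<open>finite V\<close> by simp
qed auto

text \<open>The edge lies on a cycle, so deleting it preserves connectedness; the bound for
  connected graphs, applied with one edge fewer, improves by one.\<close>

lemma card_le_if_bypass:
  assumes "finite E" "connected_on V E" "{u, w} \<in> E" "(u, w) \<in> (adj (E - {{u, w}}))\<^sup>*"
  shows "card V \<le> card E"
proof -
  let ?F = "E - {{u, w}}"
  have "adj E \<subseteq> (adj ?F)\<^sup>*"
  proof (rule subrelI)
    fix x y assume xy: "(x, y) \<in> adj E"
    show "(x, y) \<in> (adj ?F)\<^sup>*"
    proof (cases "{x, y} = {u, w}")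
      case True
      then have "x = u \<and> y = w \<or> x = w \<and> y = u" by (simp only: doubleton_eq_iff)
      then show ?thesis using assms(4) rtrancl_adj_sym[OF assms(4)] by (elim disjE conjE) simp_all
    next
      case False
      then have "(x, y) \<in> adj ?F" using xy by (auto simp: adj_def)
      then show ?thesis by (rule r_into_rtrancl)
    qed
  qed
  then have "(adj E)\<^sup>* \<subseteq> (adj ?F)\<^sup>*" by (rule rtrancl_subset_rtrancl)
  then have "connected_on V ?F" using assms(2) unfolding connected_on_def by (meson subsetD)
  then have "card V \<le> Suc (card ?F)" using assms(1) by (intro card_le_Suc_card_edges) auto
  also have "Suc (card ?F) = card E" using assms(1,3) by (rule card_Suc_Diff1)
  finally show ?thesis .
qed

text \<open>Following the path and then the edge from \<open>p (l - 1)\<close> to \<open>w\<close>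
  bypasses the edge \<open>{p 0, w}\<close>. The vertex \<open>w\<close> may lie on the path;
  \<open>w \<noteq> p 1\<close> excludes just the case where the path starts with that edge.\<close>

lemma card_le_if_path_and_cherry:
  assumes "finite E" "connected_on V E" "path_in E l p" "l \<ge> 2"
    "{p 0, w} \<in> E" "{w, p (l - 1)} \<in> E" "w \<noteq> p 1"
  shows "card V \<le> card E"
proof (rule card_le_if_bypass[OF assms(1,2,5)])
  let ?F = "E - {{p 0, w}}"
  have inj: "p i = p j \<longleftrightarrow> i = j" if "i < l" "j < l" for i j
    using assms(3) that by (auto simp: path_in_def inj_on_def)
  have "path_in ?F l p"
  proof (rule path_in_mono[OF assms(3)])
    fix j assume j: "Suc j < l"
    then have "{p j, p (Suc j)} \<noteq> {p 0, w}"
      using inj[of j 0] inj[of "Suc j" 0] assms(7) by (auto simp: doubleton_eq_iff)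
    then show "{p j, p (Suc j)} \<in> ?F" using assms(3) j by (auto simp: path_in_def)
  qed
  then have "(p 0, p (l - 1)) \<in> (adj ?F)\<^sup>*" using assms(4) by (intro path_in_rtrancl) auto
  moreover have "p (l - 1) \<noteq> p 0" using inj[of "l - 1" 0] assms(4) by auto
  then have "(p (l - 1), w) \<in> adj ?F"
    using assms(6) by (auto simp: adj_def doubleton_eq_iff insert_commute)
  ultimately show "(p 0, w) \<in> (adj ?F)\<^sup>*" by (rule rtrancl_into_rtrancl)
qed

text \<open>On four or more vertices the second and the second to last vertex of the path differ, so
  \<open>w\<close> is not the second vertex of both the path and its reversal.\<close>

lemma card_le_if_long_path_and_cherry:
  assumes "finite E" "connected_on V E" "path_in E l p" "l \<ge> 4"
    "{p 0, w} \<in> E" "{w, p (l - 1)} \<in> E"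
  shows "card V \<le> card E"
proof (cases "w = p 1")
  case False
  then show ?thesis using assms by (intro card_le_if_path_and_cherry[of E V l p w]) auto
next
  case True
  let ?q = "\<lambda>j. p (l - 1 - j)"
  have "inj_on p {..<l}" using assms(3) by (simp add: path_in_def)
  then have "p 1 \<noteq> p (l - 2)" using assms(4) by (auto dest: inj_onD)
  moreover have "l - 1 - 1 = l - 2" by simp
  ultimately have "w \<noteq> ?q 1" using True by simp
  moreover have "{?q 0, w} \<in> E" "{w, ?q (l - 1)} \<in> E" using assms(5,6) by (simp_all add: insert_commute)
  ultimately show ?thesis
    using card_le_if_path_and_cherry[OF assms(1,2) path_in_rev[OF assms(3)]] assms(4) by simp
qed

section \<open>From new copies of a cycle to paths\<close>

lemma contains_copy_cycle_graph_iff: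
  "contains_copy H (cycle_graph l) \<longleftrightarrow>
     (\<exists>f. inj_on f {..<l} \<and> f ` {..<l} \<subseteq> verts H \<and> (\<forall>i<l. {f i, f (Suc i mod l)} \<in> edges H))"
proof -
  have "(\<forall>e \<in> edges (cycle_graph l). f ` e \<in> edges H) \<longleftrightarrow>
        (\<forall>i<l. {f i, f (Suc i mod l)} \<in> edges H)" for f
    unfolding cycle_graph_def by (auto simp: setcompr_eq_image)
  then show ?thesis by (simp add: contains_copy_def cycle_graph_def)
qed

text \<open>The new cycle must pass through \<open>e\<close>, and does so only once; cutting it
  there leaves a path on all its \<open>l\<close> vertices.\<close>

lemma new_copy_of_cycle_path:
  assumes l: "l \<ge> 3"
    and no: "\<not> contains_copy H (cycle_graph l)"
    and yes: "contains_copy (add_edge H e) (cycle_graph l)"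
  obtains p where "path_in (edges H) l p" "e = {p 0, p (l - 1)}"
proof -
  obtain f where inj: "inj_on f {..<l}" and fV: "f ` {..<l} \<subseteq> verts H"
    and fE: "\<And>i. i < l \<Longrightarrow> {f i, f (Suc i mod l)} \<in> insert e (edges H)"
    using yes unfolding contains_copy_cycle_graph_iff add_edge_def by (metis ugraph.sel)
  obtain i where i: "i < l" "{f i, f (Suc i mod l)} = e"
    using no inj fV fE unfolding contains_copy_cycle_graph_iff by blast
  \<comment> \<open>A second position of \<open>e\<close> would traverse it backwards, making
    \<open>i\<close> and \<open>j\<close> successors of each other modulo \<open>l\<close>, which
    \<open>l \<ge> 3\<close> forbids.\<close>
  have unique: "j = i" if "j < l" "{f j, f (Suc j mod l)} = e" for j
  proof (rule ccontr)
    assume "j \<noteq> i"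
    have feq: "f a = f b \<longleftrightarrow> a = b" if "a < l" "b < l" for a b
      using inj that by (auto simp: inj_on_def)
    have "f j = f (Suc i mod l) \<and> f (Suc j mod l) = f i"
      using that i \<open>j \<noteq> i\<close> feq by (auto simp: doubleton_eq_iff)
    then have "j = Suc i mod l" "i = Suc j mod l"
      using feq that(1) i(1) l by auto
    moreover have "Suc m mod l = (if Suc m = l then 0 else Suc m)" if "m < l" for m
      using that by auto
    ultimately show False using that(1) i(1) l by (auto split: if_splits)
  qed
  \<comment> \<open>The cycle is renumbered to start just after \<open>e\<close>, so that it ends at
    \<open>f i\<close>.\<close>
  define p where "p j = f ((Suc i + j) mod l)" for j
  have "inj_on p {..<l}"
  proof (rule inj_onI)
    fix a b assume ab: "a \<in> {..<l}" "b \<in> {..<l}" "p a = p b"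
    then have "(Suc i + a) mod l = (Suc i + b) mod l"
      using inj l by (auto simp: p_def inj_on_def)
    then have "a mod l = b mod l" by (simp add: nat_mod_eq_iff)
    then show "a = b" using ab by simp
  qed
  moreover have "{p j, p (Suc j)} \<in> edges H" if "Suc j < l" for j
  proof -
    let ?m = "(Suc i + j) mod l"
    have "?m < l" using l by simp
    \<comment> \<open>Position \<open>i\<close> is reached only at \<open>j = l - 1\<close>, beyond
      the last edge of the path.\<close>
    moreover have "?m \<noteq> i"
    proof
      assume "?m = i"
      show False
      proof (cases "Suc i + j < l")
        case False
        then have "?m = Suc i + j - l" using that i(1) by (simp add: mod_if)
        then show False using \<open>?m = i\<close> that False by auto
      qed (use \<open>?m = i\<close> in simp)
    qed
    ultimately have "{f ?m, f (Suc ?m mod l)} \<in> edges H" using fE unique by blast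
    then show ?thesis by (simp add: p_def mod_Suc_eq)
  qed
  moreover have "p (l - 1) = f i"
  proof -
    have "Suc i + (l - 1) = i + l" using l by simp
    then show ?thesis using i(1) by (simp add: p_def)
  qed
  then have "e = {p 0, p (l - 1)}" using i(2) by (auto simp: p_def)
  ultimately show thesis using that by (auto simp: path_in_def)
qed

lemma saturated_cycle_path:
  assumes "l \<ge> 3" "saturated G (cycle_graph l) H" "{u, v} \<in> edges G" "{u, v} \<notin> edges H"
  obtains p where "path_in (edges H) l p" "p 0 = u" "p (l - 1) = v"
proof -
  have "\<not> contains_copy H (cycle_graph l)" "contains_copy (add_edge H {u, v}) (cycle_graph l)"
    using assms(2-4) by (auto simp: saturated_def)
  then obtain p where p: "path_in (edges H) l p" "{u, v} = {p 0, p (l - 1)}"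
    using new_copy_of_cycle_path[OF assms(1)] by metis
  then consider "p 0 = u" "p (l - 1) = v" | "p 0 = v" "p (l - 1) = u"
    by (auto simp: doubleton_eq_iff)
  then show thesis
  proof cases
    case 1
    then show thesis using p that by blast
  \<comment> \<open>The path came out in the opposite direction.\<close>
  next
    case 2
    then show thesis using that[OF path_in_rev[OF p(1)]] by simp
  qed
qed

section \<open>Saturated subgraphs of complete multipartite graphs\<close>

lemma edges_complete_multipartite_iff:
  "{u, v} \<in> edges (complete_multipartite k n) \<longleftrightarrow>
     u \<in> {..<k} \<times> {..<n} \<and> v \<in> {..<k} \<times> {..<n} \<and> fst u \<noteq> fst v"
  by (cases u; cases v) (auto simp: complete_multipartite_def doubleton_eq_iff)

lemma saturated_cycle_connected:
  assumes "l \<ge> 3" "k \<ge> 2" "saturated (complete_multipartite k n) (cycle_graph l) H"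
  shows "connected_on ({..<k} \<times> {..<n}) (edges H)"
proof -
  let ?V = "{..<k} \<times> {..<n}"
  have diff: "(u, v) \<in> (adj (edges H))\<^sup>*" if "u \<in> ?V" "v \<in> ?V" "fst u \<noteq> fst v" for u v
  proof (cases "{u, v} \<in> edges H")
    case True
    then show ?thesis by (auto simp: adj_def)
  next
    case False
    have "{u, v} \<in> edges (complete_multipartite k n)"
      using that by (simp add: edges_complete_multipartite_iff)
    then obtain p where "path_in (edges H) l p" "p 0 = u" "p (l - 1) = v"
      using saturated_cycle_path[OF assms(1,3) _ False] by blast
    then show ?thesis using path_in_rtrancl[of "edges H" l p "l - 1"] assms(1) by auto
  qed
  show ?thesis unfolding connected_on_def
  proof (intro ballI)
    fix u v assume uv: "u \<in> ?V" "v \<in> ?V"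
    show "(u, v) \<in> (adj (edges H))\<^sup>*"
    proof (cases "fst u = fst v")
      case True
      \<comment> \<open>Two vertices of one part are linked through a vertex of another
        part.\<close>
      define w where "w = (if fst u = 0 then 1 else 0 :: nat, snd u)"
      have "w \<in> ?V" "fst u \<noteq> fst w" "fst w \<noteq> fst v" using uv assms(2) True by (auto simp: w_def)
      then show ?thesis using diff uv by (meson rtrancl_trans)
    qed (use diff uv in blast)
  qed
qed

lemma saturated_cycle_card_edges:
  assumes l: "l \<ge> 4" and k: "k \<ge> 3" and n: "n > 0"
    and sat: "saturated (complete_multipartite k n) (cycle_graph l) H"
  shows "k * n \<le> card (edges H)"
proof (rule ccontr)
  assume less: "\<not> k * n \<le> card (edges H)"
  let ?V = "{..<k} \<times> {..<n}" and ?E = "edges H" and ?G = "complete_multipartite k n"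
  have sub: "?E \<subseteq> edges ?G" using sat by (auto simp: saturated_def spanning_subgraph_def)
  have "edges ?G \<subseteq> Pow ?V" by (auto simp: complete_multipartite_def)
  then have fin: "finite ?E" using sub by (meson finite_Pow_iff finite_SigmaI finite_lessThan finite_subset)
  have conn: "connected_on ?V ?E" using saturated_cycle_connected[OF _ _ sat] l k by simp
  have few: "\<not> card ?V \<le> card ?E" using less by simp
  have edgeD: "x \<in> ?V \<and> y \<in> ?V \<and> fst x \<noteq> fst y" if "{x, y} \<in> ?E" for x y
    using that sub edges_complete_multipartite_iff by blast
  have cherry: "fst u = fst v" if uw: "{u, w} \<in> ?E" and wv: "{w, v} \<in> ?E" for u v w
  proof (rule ccontr)
    assume ne: "fst u \<noteq> fst v"
    show False
    proof (cases "{u, v} \<in> ?E")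
      \<comment> \<open>Here \<open>u\<close>, \<open>w\<close>, \<open>v\<close> form a triangle,
        and the detour through \<open>v\<close> bypasses the edge \<open>{u, w}\<close>.\<close>
      case True
      have "w \<noteq> u" "w \<noteq> v" "u \<noteq> v" using edgeD[OF uw] edgeD[OF wv] ne by auto
      then have "(u, v) \<in> adj (?E - {{u, w}})" "(v, w) \<in> adj (?E - {{u, w}})"
        using True wv by (auto simp: adj_def doubleton_eq_iff insert_commute)
      then have "(u, w) \<in> (adj (?E - {{u, w}}))\<^sup>*" by (meson r_into_rtrancl rtrancl_into_rtrancl)
      then show False using card_le_if_bypass[OF fin conn uw] few by blast
    next
      case False
      have "{u, v} \<in> edges ?G"
        using edgeD[OF uw] edgeD[OF wv] ne by (simp add: edges_complete_multipartite_iff)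
      then obtain p where "path_in ?E l p" "p 0 = u" "p (l - 1) = v"
        using saturated_cycle_path[OF _ sat _ False] l by auto
      then show False
        using card_le_if_long_path_and_cherry[OF fin conn _ l] uw wv few by blast
    qed
  qed
  let ?x = "(0, 0) :: nat \<times> nat"
  have V: "(c, 0) \<in> ?V" if "c < 3" for c using that k n by auto
  have reach: "(?x, (c, 0)) \<in> (adj ?E)\<^sup>*" if "c < 3" for c
    using conn V that unfolding connected_on_def by simp
  obtain w where w: "{?x, w} \<in> ?E"
    using reach[of 1] by (cases rule: converse_rtranclE) (simp_all add: adj_def)
  define b where "b = fst w"
  \<comment> \<open>Walks from \<open>?x\<close> alternate between the parts \<open>0\<close> and
    \<open>b\<close>. The invariant also records the part of all neighbours of \<open>y\<close>,
    which locates the next vertex.\<close>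
  have "(fst y = 0 \<and> (\<forall>z. {y, z} \<in> ?E \<longrightarrow> fst z = b)) \<or>
        (fst y = b \<and> (\<forall>z. {y, z} \<in> ?E \<longrightarrow> fst z = 0))" if "(?x, y) \<in> (adj ?E)\<^sup>*" for y
    using that
  proof (induction rule: rtrancl_induct)
    case base
    have "fst z = b" if "{?x, z} \<in> ?E" for z
      using cherry[of w ?x z] w that by (simp add: b_def insert_commute)
    then show ?case by simp
  next
    case (step y z)
    then have yz: "{y, z} \<in> ?E" by (simp add: adj_def)
    then have "fst t = fst y" if "{z, t} \<in> ?E" for t using cherry[OF yz that] by simp
    with yz step.IH show ?case by metis
  qed
  \<comment> \<open>Reaching the parts \<open>1\<close> and \<open>2\<close> would force
    \<open>b = 1\<close> and \<open>b = 2\<close>.\<close>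
  from this[OF reach[of 1]] this[OF reach[of 2]] show False by auto
qed

section \<open>The minimum in \<open>sat\<close> is attained\<close>

text \<open>A maximal edge set without a copy of \<open>F\<close> is saturated; the empty set is a
  candidate because \<open>F\<close> has an edge.\<close>

lemma saturated_exists:
  assumes "simple_graph G" "edges F \<noteq> {}"
  shows "\<exists>H. saturated G F H"
proof -
  define S where "S = {E. E \<subseteq> edges G \<and> \<not> contains_copy (Graph (verts G) E) F}"
  have "edges G \<subseteq> Pow (verts G)" "finite (verts G)" using assms(1) by (auto simp: simple_graph_def)
  then have "finite (edges G)" by (meson finite_Pow_iff finite_subset)
  then have "finite S" unfolding S_def by simp
  moreover have "{} \<in> S" using assms(2) by (auto simp: S_def contains_copy_def)
  ultimately obtain E where E: "E \<in> S" "\<And>E'. E' \<in> S \<Longrightarrow> E \<subseteq> E' \<Longrightarrow> E = E'"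
    using finite_has_maximal[of S] by blast
  have "contains_copy (Graph (verts G) (insert e E)) F" if "e \<in> edges G - E" for e
    using E(2)[of "insert e E"] E(1) that by (auto simp: S_def)
  then have "saturated G F (Graph (verts G) E)"
    using E(1) by (auto simp: saturated_def spanning_subgraph_def add_edge_def S_def)
  then show ?thesis ..
qed

text \<open>\<open>Min\<close> returns a member only of a finite nonempty set: finiteness comes from
  the bound \<open>card (edges G)\<close>, nonemptiness from the existence of a saturated
  graph.\<close>

lemma sat_attained:
  assumes "simple_graph G" "edges F \<noteq> {}"
  obtains H where "saturated G F H" "sat G F = card (edges H)"
proof -
  let ?M = "{card (edges H) | H. saturated G F H}"
  have "edges G \<subseteq> Pow (verts G)" "finite (verts G)" using assms(1) by (auto simp: simple_graph_def)
  then have "finite (edges G)" by (meson finite_Pow_iff finite_subset)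
  then have "?M \<subseteq> {..card (edges G)}"
    by (auto simp: saturated_def spanning_subgraph_def intro: card_mono)
  then have "finite ?M" by (rule finite_subset) simp
  moreover have "?M \<noteq> {}" using saturated_exists[OF assms] by auto
  ultimately have "sat G F \<in> ?M" unfolding sat_def by (rule Min_in)
  then show thesis using that by auto
qed

theorem theorem1p2:
  fixes l k n :: nat
  assumes "l \<ge> 4" and "k \<ge> 3" and "real n \<ge> real l / real k"
  shows "sat (complete_multipartite k n) (cycle_graph l) \<ge> k * n"
proof -
  have "real l / real k > 0" using assms by simp
  then have "n > 0" using assms(3) by linarith
  have "{0, 1 mod l} \<in> edges (cycle_graph l)" using assms(1) by (force simp: cycle_graph_def)
  then have "edges (cycle_graph l) \<noteq> {}" by blast
  then obtain H where "saturated (complete_multipartite k n) (cycle_graph l) H"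
    "sat (complete_multipartite k n) (cycle_graph l) = card (edges H)"
    using sat_attained[OF simple_complete_multipartite] by blast
  then show ?thesis using saturated_cycle_card_edges assms(1,2) \<open>n > 0\<close> by simp
qed

end
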